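(* Let $(\mathbb{X},\Gamma/{\sim})$ be a triple with path category $C$, and let $\mathfrak{P}$ be a screen of $(\mathbb{X},\Gamma/{\sim})$. Let $\Sigma_{\mathfrak{P}}$ be the class of morphisms $[\rho]$ in $C$ such that $\mathrm{im}(\rho)\subset\mathsf{X}$ for some $\mathsf{X}\in\mathfrak{P}$. Then $\Sigma_{\mathfrak{P}}$ admits a calculus of fractions in $C$.
   Context: TRIPLES. A path in a nonempty set $\mathbb{X}$ is any function $\gamma:[0,1]\to\mathbb{X}$; $\mathrm{im}(\gamma)$ is its image. If $\gamma(1)=\gamma'(0)$, then $\gamma\cdot\gamma'$ is the path equal to $\gamma(2t)$ for $0\le t\le\frac12$ and to $\gamma'(2t-1)$ for $\frac12\le t\le1$. A triple $(\mathbb{X},\Gamma/{\sim})$ consists of a nonempty set $\mathbb{X}$, a set $\Gamma$ of paths in $\mathbb{X}$, and an equivalence relation $\sim$ on $\Gamma$ (equivalent paths have the same endpoints) such that: (a) $\gamma,\gamma'\in\Gamma$ with $\gamma(1)=\gamma'(0)$ implies $\gamma\cdot\gamma'\in\Gamma$; (b) if $\gamma\in\Gamma$ and $\phi:[0,1]\to[0,1]$ is weakly order preserving and sends intervals to intervals, then $\gamma\circ\phi\in\Gamma$; (c) all constant paths are in $\Gamma$; (d) a path equivalent to a constant path is constant; (e) if in (b) also $\phi(0)=0$, $\phi(1)=1$, then $\gamma\sim\gamma\circ\phi$; (f) if $\gamma,\gamma',\rho,\rho'\in\Gamma$ and $\rho\cdot\gamma\cdot\rho'$, $\rho\cdot\gamma'\cdot\rho'$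 are defined and in $\Gamma$, then $\gamma\sim\gamma'$ if and only if $\rho\cdot\gamma\cdot\rho'\sim\rho\cdot\gamma'\cdot\rho'$. The class of $\gamma$ is $[\gamma]$. SCREENS. A screen of $(\mathbb{X},\Gamma/{\sim})$ is a partition $\mathfrak{P}$ of $\mathbb{X}$, whose elements are called pixels, such that: (S1) if $\gamma,\gamma'\in\Gamma$ have the same start and the same end and $\mathrm{im}(\gamma)\subset\mathsf{X}\in\mathfrak{P}$, then $\gamma\sim\gamma'$ if and only if $\mathrm{im}(\gamma')\subset\mathsf{X}$; (S2) any two points $x,y$ of a pixel $\mathsf{X}$ are joined by a finite walk $\gamma_0\cdot\gamma_1^{-1}\cdot\gamma_2\cdots\gamma_{2n-1}^{-1}\cdot\gamma_{2n}$ from $x$ to $y$ (where $\gamma^{-1}$ is $\gamma$ run backwards) with all $\gamma_i\in\Gamma$ and $\mathrm{im}(\gamma_i)\subset\mathsf{X}$; (S3) if $\rho,\gamma\in\Gamma$, $\rho(0)=\gamma(0)$ and $\mathrm{im}(\rho)$ lies in a pixel, then there are $\rho',\gamma'\in\Gamma$ with $\mathrm{im}(\rho')$ in a pixel and $\gamma\cdot\rho'\sim\rho\cdot\gamma'$; dually, if $\rho',\gamma'\in\Gamma$, $\rho'(1)=\gamma'(1)$ and $\mathrm{im}(\rho')$ lies in a pixel, then there are $\rho,\gamma\in\Gamma$ with $\mathrm{im}(\rho)$ in a pixel and $\gamma\cdot\rho'\sim\rho\cdot\gamma'$; (S4) for every $\gamma\in\Gamma$ there are a finite partition $\{I_i\}_{i=1}^n$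 of $[0,1]$ into subintervals (listed in increasing order) and pixels $(\mathsf{X}_1,\dots,\mathsf{X}_n)$ with $\gamma(I_i)\subset\mathsf{X}_i$, where for $i\ne j$ the equality $\mathsf{X}_i=\mathsf{X}_j$ is allowed only if $|i-j|>1$; (S5) if $\gamma,\gamma'\in\Gamma$ have the same start and the same end and admit the same partition $\{I_i\}$ and the same list of pixels as in (S4), then $\gamma\sim\gamma'$. PATH CATEGORY. The path category $C$ has objects the points of $\mathbb{X}$, $\mathrm{Hom}_C(x,y)=\{[\gamma]\mid\gamma\in\Gamma,\ \gamma(0)=x,\ \gamma(1)=y\}$, and composition $[\gamma']\circ[\gamma]=[\gamma\cdot\gamma']$; identities are classes of constant paths. CALCULUS OF FRACTIONS. A class $\Sigma$ of morphisms of a category $\mathcal{D}$ admits a calculus of fractions if: (1) $\Sigma$ contains all identities and is closed under composition; (2) for $\sigma:x\to x'$ in $\Sigma$ and $f:x\to y$ there are $\sigma':y\to y'$ in $\Sigma$ and $f':x'\to y'$ with $f'\sigma=\sigma'f$; (3) if $\sigma:w\to x$ is in $\Sigma$ and $f,g:x\rightrightarrows y$ satisfy $f\sigma=g\sigma$, there is $\sigma':y\to z$ in $\Sigma$ with $\sigma'f=\sigma'g$; (4) and (5) the duals of (2) and (3). *)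

theory Defs
  imports "HOL-Analysis.Analysis"
begin

section \<open>Paths\<close>

text \<open>
  A path in a set \<open>X\<close> is an arbitrary (not necessarily continuous) function on the unit interval.
  Paths are extensional functions, so that two of them are equal as soon as they agree
  on \<open>{0..1}\<close>.
\<close>

definition paths_in :: "'a set \<Rightarrow> (real \<Rightarrow> 'a) set"
  where "paths_in X = ({0..1} \<rightarrow>\<^sub>E X)"

definition im :: "(real \<Rightarrow> 'a) \<Rightarrow> 'a set"
  where "im g = g ` {0..1}"

definition const_path :: "'a \<Rightarrow> real \<Rightarrow> 'a"
  where "const_path x = (\<lambda>t\<in>{0..1}. x)"

definition rev_path :: "(real \<Rightarrow> 'a) \<Rightarrow> real \<Rightarrow> 'a"
  where "rev_path g = (\<lambda>t\<in>{0..1}. g (1 - t))"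

text \<open>
  The formula is total; it is the intended concatenation only if \<open>composable g h\<close> holds, and this
  is required explicitly wherever a concatenation is said to be defined.
\<close>

definition path_concat :: "(real \<Rightarrow> 'a) \<Rightarrow> (real \<Rightarrow> 'a) \<Rightarrow> real \<Rightarrow> 'a"  (infixl \<open>\<cdot>\<^sub>p\<close> 70)
  where "g \<cdot>\<^sub>p h = (\<lambda>t\<in>{0..1}. if t \<le> 1 / 2 then g (2 * t) else h (2 * t - 1))"

definition composable :: "(real \<Rightarrow> 'a) \<Rightarrow> (real \<Rightarrow> 'a) \<Rightarrow> bool"
  where "composable g h \<longleftrightarrow> g 1 = h 0"

text \<open>Degenerate intervals (single points) count as intervals, here and in the subdivisions below.\<close>

definition reparam :: "(real \<Rightarrow> real) \<Rightarrow> bool"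
  where "reparam \<phi> \<longleftrightarrow>
    \<phi> \<in> {0..1} \<rightarrow> {0..1} \<and> mono_on {0..1} \<phi> \<and>
    (\<forall>I. I \<subseteq> {0..1} \<and> is_interval I \<longrightarrow> is_interval (\<phi> ` I))"


section \<open>Triples\<close>

text \<open>
  The path \<open>compose {0..1} g \<phi>\<close> is the reparametrisation of \<open>g\<close> by \<open>\<phi>\<close>.  The threefold
  concatenation in \<open>cancel\<close> is bracketed to the left; by \<open>reparam_rel\<close> the other bracketing is
  equivalent to it.
\<close>

locale path_triple =
  fixes X :: "'a set" and \<Gamma> :: "(real \<Rightarrow> 'a) set" and R :: "(real \<Rightarrow> 'a) rel"
  assumes nonempty: "X \<noteq> {}"
    and paths: "\<Gamma> \<subseteq> paths_in X"
    and equiv_R: "equiv \<Gamma> R"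
    and endpoints: "(g, h) \<in> R \<Longrightarrow> g 0 = h 0 \<and> g 1 = h 1"
    and concat_closed: "\<lbrakk>g \<in> \<Gamma>; h \<in> \<Gamma>; composable g h\<rbrakk> \<Longrightarrow> g \<cdot>\<^sub>p h \<in> \<Gamma>"
    and reparam_closed: "\<lbrakk>g \<in> \<Gamma>; reparam \<phi>\<rbrakk> \<Longrightarrow> compose {0..1} g \<phi> \<in> \<Gamma>"
    and const_closed: "x \<in> X \<Longrightarrow> const_path x \<in> \<Gamma>"
    and const_rel: "\<lbrakk>x \<in> X; (g, const_path x) \<in> R\<rbrakk> \<Longrightarrow> \<exists>y\<in>X. g = const_path y"
    and reparam_rel:
      "\<lbrakk>g \<in> \<Gamma>; reparam \<phi>; \<phi> 0 = 0; \<phi> 1 = 1\<rbrakk> \<Longrightarrow> (g, compose {0..1} g \<phi>) \<in> R"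
    and cancel:
      "\<lbrakk>g \<in> \<Gamma>; g' \<in> \<Gamma>; r \<in> \<Gamma>; r' \<in> \<Gamma>;
        composable r g; composable g r'; composable r g'; composable g' r';
        (r \<cdot>\<^sub>p g) \<cdot>\<^sub>p r' \<in> \<Gamma>; (r \<cdot>\<^sub>p g') \<cdot>\<^sub>p r' \<in> \<Gamma>\<rbrakk>
       \<Longrightarrow> (g, g') \<in> R \<longleftrightarrow> ((r \<cdot>\<^sub>p g) \<cdot>\<^sub>p r', (r \<cdot>\<^sub>p g') \<cdot>\<^sub>p r') \<in> R"


section \<open>Screens\<close>

text \<open>
  A walk \<open>\<gamma>\<^sub>0 \<cdot> \<gamma>\<^sub>1\<^sup>-\<^sup>1 \<cdot> \<dots> \<cdot> \<gamma>\<^sub>2\<^sub>n\<close> is given by the sequence \<open>g\<close> of its \<open>2 * n + 1\<close> paths; those with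
  odd index are run backwards.
\<close>

definition walk_step :: "(nat \<Rightarrow> real \<Rightarrow> 'a) \<Rightarrow> nat \<Rightarrow> real \<Rightarrow> 'a"
  where "walk_step g i = (if even i then g i else rev_path (g i))"

definition joined_by_walk :: "(real \<Rightarrow> 'a) set \<Rightarrow> 'a set \<Rightarrow> 'a \<Rightarrow> 'a \<Rightarrow> bool"
  where "joined_by_walk \<Gamma> A x y \<longleftrightarrow>
    (\<exists>n g. (\<forall>i\<le>2 * n. g i \<in> \<Gamma> \<and> im (g i) \<subseteq> A) \<and>
           (\<forall>i<2 * n. composable (walk_step g i) (walk_step g (Suc i))) \<and>
           walk_step g 0 0 = x \<and> walk_step g (2 * n) 1 = y)"

text \<open>A finite partition of the unit interval into subintervals, listed in increasing order.\<close>

definition interval_subdivision :: "real set list \<Rightarrow> bool"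
  where "interval_subdivision Is \<longleftrightarrow>
    (\<forall>I\<in>set Is. is_interval I \<and> I \<noteq> {}) \<and>
    sorted_wrt (\<lambda>I J. \<forall>s\<in>I. \<forall>t\<in>J. s < t) Is \<and>
    \<Union>(set Is) = {0..1}"

definition admits_subdivision ::
  "'a set set \<Rightarrow> (real \<Rightarrow> 'a) \<Rightarrow> real set list \<Rightarrow> 'a set list \<Rightarrow> bool"
  where "admits_subdivision P g Is Xs \<longleftrightarrow>
    interval_subdivision Is \<and> length Xs = length Is \<and> set Xs \<subseteq> P \<and>
    (\<forall>i<length Is. g ` (Is ! i) \<subseteq> Xs ! i) \<and>
    (\<forall>i<length Is. \<forall>j<length Is. i \<noteq> j \<and> Xs ! i = Xs ! j \<longrightarrow> \<bar>int i - int j\<bar> > 1)"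

definition in_pixel :: "'a set set \<Rightarrow> (real \<Rightarrow> 'a) \<Rightarrow> bool"
  where "in_pixel P g \<longleftrightarrow> (\<exists>A\<in>P. im g \<subseteq> A)"

locale screen = path_triple +
  fixes P :: "'a set set"
  assumes partition: "partition_on X P"
    and S1: "\<lbrakk>g \<in> \<Gamma>; g' \<in> \<Gamma>; g 0 = g' 0; g 1 = g' 1; A \<in> P; im g \<subseteq> A\<rbrakk>
      \<Longrightarrow> (g, g') \<in> R \<longleftrightarrow> im g' \<subseteq> A"
    and S2: "\<lbrakk>A \<in> P; x \<in> A; y \<in> A\<rbrakk> \<Longrightarrow> joined_by_walk \<Gamma> A x y"
    and S3: "\<lbrakk>r \<in> \<Gamma>; g \<in> \<Gamma>; r 0 = g 0; in_pixel P r\<rbrakk>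
      \<Longrightarrow> \<exists>r'\<in>\<Gamma>. \<exists>g'\<in>\<Gamma>. in_pixel P r' \<and> composable g r' \<and> composable r g' \<and>
            (g \<cdot>\<^sub>p r', r \<cdot>\<^sub>p g') \<in> R"
    and S3_dual: "\<lbrakk>r' \<in> \<Gamma>; g' \<in> \<Gamma>; r' 1 = g' 1; in_pixel P r'\<rbrakk>
      \<Longrightarrow> \<exists>r\<in>\<Gamma>. \<exists>g\<in>\<Gamma>. in_pixel P r \<and> composable g r' \<and> composable r g' \<and>
            (g \<cdot>\<^sub>p r', r \<cdot>\<^sub>p g') \<in> R"
    and S4: "g \<in> \<Gamma> \<Longrightarrow> \<exists>Is Xs. admits_subdivision P g Is Xs"
    and S5: "\<lbrakk>g \<in> \<Gamma>; g' \<in> \<Gamma>; g 0 = g' 0; g 1 = g' 1;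
        admits_subdivision P g Is Xs; admits_subdivision P g' Is Xs\<rbrakk> \<Longrightarrow> (g, g') \<in> R"


section \<open>Categories and calculi of fractions\<close>

record ('o, 'm) cat_data =
  Obj :: "'o set"
  Hom :: "'o \<Rightarrow> 'o \<Rightarrow> 'm set"
  Comp :: "'m \<Rightarrow> 'm \<Rightarrow> 'm"  (infixr \<open>\<circ>\<index>\<close> 65)
  Ident :: "'o \<Rightarrow> 'm"

text \<open>
  \<open>f \<circ>\<^bsub>C\<^esub> g\<close> is first \<open>g\<close>, then \<open>f\<close>.  Hom-sets are required to be disjoint, so that a class of
  morphisms is just a set of elements of \<open>'m\<close>.
\<close>

locale category =
  fixes C :: "('o, 'm) cat_data" (structure)
  assumes comp_in_Hom: "\<lbrakk>x \<in> Obj C; y \<in> Obj C; z \<in> Obj C; f \<in> Hom C x y; g \<in> Hom C y z\<rbrakk>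
      \<Longrightarrow> g \<circ> f \<in> Hom C x z"
    and Ident_in_Hom: "x \<in> Obj C \<Longrightarrow> Ident C x \<in> Hom C x x"
    and Ident_left: "\<lbrakk>x \<in> Obj C; y \<in> Obj C; f \<in> Hom C x y\<rbrakk> \<Longrightarrow> Ident C y \<circ> f = f"
    and Ident_right: "\<lbrakk>x \<in> Obj C; y \<in> Obj C; f \<in> Hom C x y\<rbrakk> \<Longrightarrow> f \<circ> Ident C x = f"
    and comp_assoc: "\<lbrakk>w \<in> Obj C; x \<in> Obj C; y \<in> Obj C; z \<in> Obj C;
        f \<in> Hom C w x; g \<in> Hom C x y; h \<in> Hom C y z\<rbrakk> \<Longrightarrow> (h \<circ> g) \<circ> f = h \<circ> (g \<circ> f)"
    and Hom_disjoint: "\<lbrakk>x \<in> Obj C; y \<in> Obj C; x' \<in> Obj C; y' \<in> Obj C;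
        f \<in> Hom C x y; f \<in> Hom C x' y'\<rbrakk> \<Longrightarrow> x = x' \<and> y = y'"

locale calculus_of_fractions = category +
  fixes S :: "'m set"
  assumes S_morphisms: "S \<subseteq> (\<Union>x\<in>Obj C. \<Union>y\<in>Obj C. Hom C x y)"
    and F1_Ident: "x \<in> Obj C \<Longrightarrow> Ident C x \<in> S"
    and F1_comp: "\<lbrakk>x \<in> Obj C; y \<in> Obj C; z \<in> Obj C;
        s \<in> S \<inter> Hom C x y; s' \<in> S \<inter> Hom C y z\<rbrakk> \<Longrightarrow> s' \<circ> s \<in> S"
    and F2: "\<lbrakk>x \<in> Obj C; x' \<in> Obj C; y \<in> Obj C; s \<in> S \<inter> Hom C x x'; f \<in> Hom C x y\<rbrakk>
      \<Longrightarrow> \<exists>y'\<in>Obj C. \<exists>s'\<in>S \<inter> Hom C y y'. \<exists>f'\<in>Hom C x' y'. f' \<circ> s = s' \<circ> f"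
    and F3: "\<lbrakk>w \<in> Obj C; x \<in> Obj C; y \<in> Obj C; s \<in> S \<inter> Hom C w x;
        f \<in> Hom C x y; g \<in> Hom C x y; f \<circ> s = g \<circ> s\<rbrakk>
      \<Longrightarrow> \<exists>z\<in>Obj C. \<exists>s'\<in>S \<inter> Hom C y z. s' \<circ> f = s' \<circ> g"
    and F4: "\<lbrakk>x \<in> Obj C; x' \<in> Obj C; y \<in> Obj C; s \<in> S \<inter> Hom C x' x; f \<in> Hom C y x\<rbrakk>
      \<Longrightarrow> \<exists>y'\<in>Obj C. \<exists>s'\<in>S \<inter> Hom C y' y. \<exists>f'\<in>Hom C y' x'. s \<circ> f' = f \<circ> s'"
    and F5: "\<lbrakk>x \<in> Obj C; y \<in> Obj C; z \<in> Obj C; s \<in> S \<inter> Hom C y z;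
        f \<in> Hom C x y; g \<in> Hom C x y; s \<circ> f = s \<circ> g\<rbrakk>
      \<Longrightarrow> \<exists>w\<in>Obj C. \<exists>s'\<in>S \<inter> Hom C w x. f \<circ> s' = g \<circ> s'"


section \<open>The path category\<close>

text \<open>
  The class \<open>[g]\<close> is \<open>R `` {g}\<close>.  Composition of classes is the usual lifting of concatenation
  to classes; lemma \<open>path_category_comp\<close> below shows that it satisfies \<open>[h] \<circ> [g] = [g \<cdot> h]\<close>.
\<close>

definition path_category ::
  "'a set \<Rightarrow> (real \<Rightarrow> 'a) set \<Rightarrow> (real \<Rightarrow> 'a) rel \<Rightarrow> ('a, (real \<Rightarrow> 'a) set) cat_data"
  where "path_category X \<Gamma> R =
    \<lparr>Obj = X,
     Hom = (\<lambda>x y. {R `` {g} | g. g \<in> \<Gamma> \<and> g 0 = x \<and> g 1 = y}),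
     Comp = (\<lambda>B A. \<Union>g\<in>A. \<Union>h\<in>B. R `` {g \<cdot>\<^sub>p h}),
     Ident = (\<lambda>x. R `` {const_path x})\<rparr>"

definition screen_morphisms ::
  "(real \<Rightarrow> 'a) set \<Rightarrow> (real \<Rightarrow> 'a) rel \<Rightarrow> 'a set set \<Rightarrow> (real \<Rightarrow> 'a) set set"
  where "screen_morphisms \<Gamma> R P = {R `` {r} | r. r \<in> \<Gamma> \<and> (\<exists>A\<in>P. im r \<subseteq> A)}"

lemma reparamI:
  assumes "continuous_on {0..1} \<phi>" "mono_on {0..1} \<phi>" "\<phi> 0 = 0" "\<phi> 1 = 1"
  shows "reparam \<phi>"
proof -
  have "\<phi> \<in> {0..1} \<rightarrow> {0..1}"
    using monotone_onD[OF assms(2), of 0] monotone_onD[OF assms(2), of _ 1] assms(3,4) by fastforce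
  moreover have "is_interval (\<phi> ` I)" if "I \<subseteq> {0..1}" "is_interval I" for I
    using connected_continuous_image[OF continuous_on_subset[OF assms(1) that(1)]] that(2)
    by (simp add: is_interval_connected_1)
  ultimately show ?thesis
    using assms(2) by (auto simp: reparam_def)
qed

context path_triple
begin

lemma concat_cong:
  assumes R: "(g, g') \<in> R" "(h, h') \<in> R" and gh: "composable g h"
  shows "(g \<cdot>\<^sub>p h, g' \<cdot>\<^sub>p h') \<in> R"
proof -
  have sub: "R \<subseteq> \<Gamma> \<times> \<Gamma>" and sy: "sym R" and tr: "trans R"
    using equiv_R by (auto simp: equiv_def)
  have G: "g \<in> \<Gamma>" "g' \<in> \<Gamma>" "h \<in> \<Gamma>" "h' \<in> \<Gamma>" using R sub by auto
  have e: "g' 0 = g 0" "g' 1 = g 1" "h' 0 = h 0" "h' 1 = h 1" "g 1 = h 0"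
    using endpoints[OF R(1)] endpoints[OF R(2)] gh by (auto simp: composable_def)
  have val: "k 0 \<in> X" "k 1 \<in> X" if "k \<in> \<Gamma>" for k
    using that paths by (auto simp: paths_in_def PiE_def Pi_def)
  define c d where "c = const_path (g 0)" and "d = const_path (h 1)"
  have cd: "c \<in> \<Gamma>" "d \<in> \<Gamma>" using G val const_closed by (auto simp: c_def d_def)
  have cv: "c t = g 0" "d t = h 1" if "t \<in> {0..1}" for t
    using that by (auto simp: c_def d_def const_path_def)
  define \<phi> where "\<phi> = (\<lambda>t::real. max 0 (min t (2 * t - 1 / 2)))"
  define \<psi> where "\<psi> = (\<lambda>t::real. min 1 (2 * t))"
  have \<phi>: "reparam \<phi>" "\<phi> 0 = 0" "\<phi> 1 = 1"
  proof -
    show "\<phi> 0 = 0" "\<phi> 1 = 1" by (simp_all add: \<phi>_def)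
    moreover have "continuous_on {0..1} \<phi>"
      unfolding \<phi>_def by (intro continuous_intros)
    moreover have "mono_on {0..1} \<phi>"
      by (intro mono_onI) (simp add: \<phi>_def)
    ultimately show "reparam \<phi>" by (intro reparamI)
  qed
  have \<psi>: "reparam \<psi>" "\<psi> 0 = 0" "\<psi> 1 = 1"
  proof -
    show "\<psi> 0 = 0" "\<psi> 1 = 1" by (simp_all add: \<psi>_def)
    moreover have "continuous_on {0..1} \<psi>"
      unfolding \<psi>_def by (intro continuous_intros)
    moreover have "mono_on {0..1} \<psi>"
      by (intro mono_onI) (simp add: \<psi>_def)
    ultimately show "reparam \<psi>" by (intro reparamI)
  qed
  have L: "(c \<cdot>\<^sub>p k) \<cdot>\<^sub>p h = compose {0..1} (k \<cdot>\<^sub>p h) \<phi>" if "k 0 = g 0" for k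
  proof
    fix t :: real
    consider "t \<notin> {0..1}" | "0 \<le> t" "t \<le> 1/4" | "1/4 < t" "t \<le> 1/2" | "1/2 < t" "t \<le> 1"
      by force
    then show "((c \<cdot>\<^sub>p k) \<cdot>\<^sub>p h) t = compose {0..1} (k \<cdot>\<^sub>p h) \<phi> t"
    proof cases
      case 2
      then have "\<phi> t = 0" by (auto simp: \<phi>_def)
      with 2 that show ?thesis by (auto simp: compose_def path_concat_def cv)
    next
      case 3
      then have "\<phi> t = 2 * t - 1 / 2" by (auto simp: \<phi>_def)
      with 3 show ?thesis by (auto simp: compose_def path_concat_def)
    next
      case 4
      then have "\<phi> t = t" by (auto simp: \<phi>_def)
      with 4 show ?thesis by (auto simp: compose_def path_concat_def)
    qed (auto simp: compose_def path_concat_def)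
  qed
  have D: "(k \<cdot>\<^sub>p d) = compose {0..1} k \<psi>" if "k 1 = h 1" for k
  proof
    fix t :: real
    consider "t \<notin> {0..1}" | "0 \<le> t" "t \<le> 1/2" | "1/2 < t" "t \<le> 1"
      by force
    then show "(k \<cdot>\<^sub>p d) t = compose {0..1} k \<psi> t"
    proof cases
      case 2
      then have "\<psi> t = 2 * t" by (auto simp: \<psi>_def)
      with 2 show ?thesis by (auto simp: compose_def path_concat_def)
    next
      case 3
      then have "\<psi> t = 1" by (auto simp: \<psi>_def)
      with 3 that show ?thesis by (auto simp: compose_def path_concat_def cv)
    qed (auto simp: compose_def path_concat_def)
  qed
  have pc: "k \<cdot>\<^sub>p l \<in> \<Gamma>" if "k \<in> \<Gamma>" "l \<in> \<Gamma>" "k 1 = l 0" for k l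
    using that concat_closed by (auto simp: composable_def)
  have en: "(k \<cdot>\<^sub>p l) 0 = k 0" "(k \<cdot>\<^sub>p l) 1 = l 1" for k l :: "real \<Rightarrow> 'a"
    by (auto simp: path_concat_def)
  have "((c \<cdot>\<^sub>p g) \<cdot>\<^sub>p h, (c \<cdot>\<^sub>p g') \<cdot>\<^sub>p h) \<in> R"
    by (subst cancel[symmetric]) (auto simp: composable_def e cd G cv en R intro!: pc)
  then have 1: "(compose {0..1} (g \<cdot>\<^sub>p h) \<phi>, compose {0..1} (g' \<cdot>\<^sub>p h) \<phi>) \<in> R"
    by (simp add: L e)
  have "((g' \<cdot>\<^sub>p h) \<cdot>\<^sub>p d, (g' \<cdot>\<^sub>p h') \<cdot>\<^sub>p d) \<in> R"
    by (subst cancel[symmetric]) (auto simp: composable_def e cd G cv en R intro!: pc)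
  then have 2: "(compose {0..1} (g' \<cdot>\<^sub>p h) \<psi>, compose {0..1} (g' \<cdot>\<^sub>p h') \<psi>) \<in> R"
    by (simp add: D e en)
  have m: "g \<cdot>\<^sub>p h \<in> \<Gamma>" "g' \<cdot>\<^sub>p h \<in> \<Gamma>" "g' \<cdot>\<^sub>p h' \<in> \<Gamma>" by (auto intro!: pc simp: G e)
  have "(g \<cdot>\<^sub>p h, g' \<cdot>\<^sub>p h) \<in> R"
    by (rule transD[OF tr reparam_rel[OF m(1) \<phi>]
          transD[OF tr 1 symD[OF sy reparam_rel[OF m(2) \<phi>]]]])
  moreover have "(g' \<cdot>\<^sub>p h, g' \<cdot>\<^sub>p h') \<in> R"
    by (rule transD[OF tr reparam_rel[OF m(2) \<psi>]
          transD[OF tr 2 symD[OF sy reparam_rel[OF m(3) \<psi>]]]])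
  ultimately show ?thesis by (rule transD[OF tr])
qed

lemma path_category_comp:
  assumes "g \<in> \<Gamma>" "h \<in> \<Gamma>" "g 1 = h 0"
  shows "R `` {h} \<circ>\<^bsub>path_category X \<Gamma> R\<^esub> R `` {g} = R `` {g \<cdot>\<^sub>p h}"
proof -
  have "R `` {g' \<cdot>\<^sub>p h'} = R `` {g \<cdot>\<^sub>p h}" if "g' \<in> R `` {g}" "h' \<in> R `` {h}" for g' h'
  proof -
    have "(g \<cdot>\<^sub>p h, g' \<cdot>\<^sub>p h') \<in> R"
      using that assms(3) by (intro concat_cong) (auto simp: composable_def)
    then show ?thesis
      by (rule equiv_class_eq[OF equiv_R, symmetric])
  qed
  moreover have "g \<in> R `` {g}" "h \<in> R `` {h}"
    using equiv_class_self[OF equiv_R] assms(1,2) by blast+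
  ultimately have "(\<Union>g'\<in>R `` {g}. \<Union>h'\<in>R `` {h}. R `` {g' \<cdot>\<^sub>p h'}) = R `` {g \<cdot>\<^sub>p h}"
    by (metis (no_types, lifting) SUP_eq_const empty_iff)
  then show ?thesis
    by (simp add: path_category_def)
qed

end

end

theory Submission
  imports Defs
begin

text \<open>
  Axiom (S3) is exactly the Ore condition.  The cancellation conditions are immediate, because
  condition (f) on triples makes every morphism of the path category both monic and epic.
  Two composable paths that each lie in a pixel lie in the same one, since they share a point.
\<close>

section \<open>Endpoints and images of concatenated and constant paths\<close>

lemma path_concat_0 [simp]: "(g \<cdot>\<^sub>p h) 0 = g 0"
  and path_concat_1 [simp]: "(g \<cdot>\<^sub>p h) 1 = h 1"
  by (auto simp: path_concat_def)

lemma const_path_0 [simp]: "const_path x 0 = x"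
  and const_path_1 [simp]: "const_path x 1 = x"
  by (auto simp: const_path_def)

text \<open>Only an inclusion, so that composability need not be assumed: at time 1/2 the formula
  takes the value \<open>g 1\<close>, and \<open>h 0\<close> may be missed if the two
  differ.\<close>

lemma im_path_concat: "im (g \<cdot>\<^sub>p h) \<subseteq> im g \<union> im h"
  by (force simp: im_def path_concat_def)

lemma im_const_path [simp]: "im (const_path x) = {x}"
  by (force simp: im_def const_path_def)

lemma start_in_im: "g 0 \<in> im g" and end_in_im: "g 1 \<in> im g"
  by (auto simp: im_def)

section \<open>Unit laws, associativity and cancellation up to equivalence\<close>

context path_triple
begin

lemma endpoints_in: "g \<in> \<Gamma> \<Longrightarrow> g 0 \<in> X" "g \<in> \<Gamma> \<Longrightarrow> g 1 \<in> X"
  using paths by (auto simp: paths_in_def PiE_def Pi_def)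

lemma concat_in: "\<lbrakk>g \<in> \<Gamma>; h \<in> \<Gamma>; g 1 = h 0\<rbrakk> \<Longrightarrow> g \<cdot>\<^sub>p h \<in> \<Gamma>"
  using concat_closed by (simp add: composable_def)

lemma rel_sym: "(g, h) \<in> R \<Longrightarrow> (h, g) \<in> R"
  using equiv_R by (auto simp: equiv_def dest: symD)

lemma rel_trans: "\<lbrakk>(g, h) \<in> R; (h, k) \<in> R\<rbrakk> \<Longrightarrow> (g, k) \<in> R"
  using equiv_R by (auto simp: equiv_def dest: transD)

lemma rel_refl: "g \<in> \<Gamma> \<Longrightarrow> (g, g) \<in> R"
  using equiv_R by (auto simp: equiv_def dest: refl_onD)

lemma class_eq_iff: "g \<in> \<Gamma> \<Longrightarrow> h \<in> \<Gamma> \<Longrightarrow> R `` {g} = R `` {h} \<longleftrightarrow> (g, h) \<in> R"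
  by (simp add: eq_equiv_class_iff[OF equiv_R])

text \<open>Resting at the start of \<open>g\<close> for half the time and then running at double
  speed is literally a reparametrisation of \<open>g\<close> that fixes 0 and 1, so
  \<open>reparam_rel\<close> applies.\<close>

lemma const_concat_rel:
  assumes g: "g \<in> \<Gamma>"
  shows "(const_path (g 0) \<cdot>\<^sub>p g, g) \<in> R"
proof -
  define \<phi> where "\<phi> = (\<lambda>t::real. max 0 (2 * t - 1))"
  have \<phi>01: "\<phi> 0 = 0" "\<phi> 1 = 1"
    by (simp_all add: \<phi>_def)
  have "continuous_on {0..1} \<phi>"
    unfolding \<phi>_def by (intro continuous_intros)
  moreover have "mono_on {0..1} \<phi>"
    by (intro mono_onI) (simp add: \<phi>_def)
  ultimately have \<phi>: "reparam \<phi>"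
    using \<phi>01 by (intro reparamI)
  \<comment> \<open>At t = 1/2 the concatenation still uses its first branch, while
    \<open>max_def\<close> selects 2t - 1. The two values agree only after substituting 2t = 1,
    hence the case split.\<close>
  have "(const_path (g 0) \<cdot>\<^sub>p g) t = compose {0..1} g \<phi> t" for t
    by (cases "2 * t = 1")
      (auto simp: path_concat_def compose_def const_path_def \<phi>_def max_def)
  then have "const_path (g 0) \<cdot>\<^sub>p g = compose {0..1} g \<phi>" ..
  then show ?thesis
    using rel_sym[OF reparam_rel[OF g \<phi> \<phi>01]] by simp
qed

text \<open>Mirror image of \<open>const_concat_rel\<close>: \<open>g\<close> runs at double speed
  and then rests at its end, so the time change is 2t capped at 1.\<close>

lemma concat_const_rel:
  assumes g: "g \<in> \<Gamma>"
  shows "(g \<cdot>\<^sub>p const_path (g 1), g) \<in> R"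
proof -
  define \<phi> where "\<phi> = (\<lambda>t::real. min 1 (2 * t))"
  have \<phi>01: "\<phi> 0 = 0" "\<phi> 1 = 1"
    by (simp_all add: \<phi>_def)
  have "continuous_on {0..1} \<phi>"
    unfolding \<phi>_def by (intro continuous_intros)
  moreover have "mono_on {0..1} \<phi>"
    by (intro mono_onI) (simp add: \<phi>_def)
  ultimately have \<phi>: "reparam \<phi>"
    using \<phi>01 by (intro reparamI)
  have "(g \<cdot>\<^sub>p const_path (g 1)) t = compose {0..1} g \<phi> t" for t
    by (cases "2 * t = 1")
      (auto simp: path_concat_def compose_def const_path_def \<phi>_def min_def)
  then have "g \<cdot>\<^sub>p const_path (g 1) = compose {0..1} g \<phi>" ..
  then show ?thesis
    using rel_sym[OF reparam_rel[OF g \<phi> \<phi>01]] by simp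
qed

lemma concat_assoc_rel:
  assumes G: "g \<in> \<Gamma>" "h \<in> \<Gamma>" "k \<in> \<Gamma>" and e: "g 1 = h 0" "h 1 = k 0"
  shows "(g \<cdot>\<^sub>p (h \<cdot>\<^sub>p k), (g \<cdot>\<^sub>p h) \<cdot>\<^sub>p k) \<in> R"
proof -
  \<comment> \<open>The left bracketing changes path at times 1/4 and 1/2, the right one at 1/2 and
    3/4. The piecewise linear map matching these times has slopes 2, 1, 1/2; it is concave, hence
    the minimum of its three linear pieces.\<close>
  define \<phi> where "\<phi> = (\<lambda>t::real. min (2 * t) (min (t + 1 / 4) ((t + 1) / 2)))"
  have \<phi>01: "\<phi> 0 = 0" "\<phi> 1 = 1"
    by (simp_all add: \<phi>_def)
  have "continuous_on {0..1} \<phi>"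
    unfolding \<phi>_def by (intro continuous_intros) auto
  moreover have "mono_on {0..1} \<phi>"
    by (intro mono_onI) (auto simp: \<phi>_def min_def)
  ultimately have \<phi>: "reparam \<phi>"
    using \<phi>01 by (intro reparamI)
  have "((g \<cdot>\<^sub>p h) \<cdot>\<^sub>p k) t = compose {0..1} (g \<cdot>\<^sub>p (h \<cdot>\<^sub>p k)) \<phi> t" for t
  proof -
    consider "t \<notin> {0..1}" | "0 \<le> t" "t \<le> 1/4" | "1/4 < t" "t \<le> 1/2" | "1/2 < t" "t \<le> 1"
      by force
    then show ?thesis
    proof cases
      case 2
      then have "\<phi> t = 2 * t" by (auto simp: \<phi>_def)
      with 2 show ?thesis by (auto simp: compose_def path_concat_def)
    next
      case 3
      then have "\<phi> t = t + 1 / 4" by (auto simp: \<phi>_def min_def)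
      with 3 show ?thesis by (auto simp: compose_def path_concat_def algebra_simps)
    next
      case 4
      then have "\<phi> t = (t + 1) / 2" by (auto simp: \<phi>_def min_def)
      with 4 show ?thesis by (auto simp: compose_def path_concat_def algebra_simps)
    qed (auto simp: compose_def path_concat_def)
  qed
  then have "(g \<cdot>\<^sub>p h) \<cdot>\<^sub>p k = compose {0..1} (g \<cdot>\<^sub>p (h \<cdot>\<^sub>p k)) \<phi>" ..
  moreover have "g \<cdot>\<^sub>p (h \<cdot>\<^sub>p k) \<in> \<Gamma>"
    using G e by (intro concat_in) auto
  ultimately show ?thesis
    using reparam_rel[OF _ \<phi> \<phi>01] by metis
qed

text \<open>Makes every class \<open>[r]\<close> epic. Axiom \<open>cancel\<close> strips a path
  from both sides at once, so a constant path is appended to serve as the right factor.\<close>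

lemma concat_left_cancel:
  assumes G: "r \<in> \<Gamma>" "f \<in> \<Gamma>" "g \<in> \<Gamma>" and e: "r 1 = f 0" "r 1 = g 0" "f 1 = g 1"
    and fg: "(r \<cdot>\<^sub>p f, r \<cdot>\<^sub>p g) \<in> R"
  shows "(f, g) \<in> R"
proof -
  let ?d = "const_path (f 1)"
  have d: "?d \<in> \<Gamma>"
    using G by (intro const_closed endpoints_in)
  have rf: "r \<cdot>\<^sub>p f \<in> \<Gamma>" and rg: "r \<cdot>\<^sub>p g \<in> \<Gamma>"
    using G e by (auto intro: concat_in)
  have "((r \<cdot>\<^sub>p f) \<cdot>\<^sub>p ?d, (r \<cdot>\<^sub>p g) \<cdot>\<^sub>p ?d) \<in> R"
    using fg rel_refl[OF d] by (rule concat_cong) (simp add: composable_def)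
  moreover have "(r \<cdot>\<^sub>p f) \<cdot>\<^sub>p ?d \<in> \<Gamma>" "(r \<cdot>\<^sub>p g) \<cdot>\<^sub>p ?d \<in> \<Gamma>"
    using rf rg d e by (auto intro: concat_in)
  ultimately show ?thesis
    using G d e cancel[of f g r ?d] by (simp add: composable_def)
qed

text \<open>Makes every class \<open>[r]\<close> monic; a constant path now plays the left factor in
  \<open>cancel\<close>.\<close>

lemma concat_right_cancel:
  assumes G: "r \<in> \<Gamma>" "f \<in> \<Gamma>" "g \<in> \<Gamma>" and e: "f 1 = r 0" "g 1 = r 0" "f 0 = g 0"
    and fg: "(f \<cdot>\<^sub>p r, g \<cdot>\<^sub>p r) \<in> R"
  shows "(f, g) \<in> R"
proof -
  let ?c = "const_path (f 0)"
  have c: "?c \<in> \<Gamma>"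
    using G by (intro const_closed endpoints_in)
  have cf: "?c \<cdot>\<^sub>p f \<in> \<Gamma>" and cg: "?c \<cdot>\<^sub>p g \<in> \<Gamma>"
    using G c e by (auto intro: concat_in)
  \<comment> \<open>Since \<open>cancel\<close> brackets to the left, \<open>?c\<close> has to be
    joined to \<open>f\<close> and \<open>g\<close> before \<open>r\<close> is appended. The unit
    law is therefore used inside the concatenation, and \<open>concat_cong\<close> carries it past
    \<open>r\<close>.\<close>
  have "((?c \<cdot>\<^sub>p f) \<cdot>\<^sub>p r, f \<cdot>\<^sub>p r) \<in> R"
    by (intro concat_cong rel_refl const_concat_rel G) (simp add: composable_def e)
  moreover have "((?c \<cdot>\<^sub>p g) \<cdot>\<^sub>p r, g \<cdot>\<^sub>p r) \<in> R"
    using const_concat_rel[OF G(3)] e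
    by (intro concat_cong rel_refl G) (simp_all add: composable_def)
  ultimately have "((?c \<cdot>\<^sub>p f) \<cdot>\<^sub>p r, (?c \<cdot>\<^sub>p g) \<cdot>\<^sub>p r) \<in> R"
    using fg rel_sym rel_trans by blast
  moreover have "(?c \<cdot>\<^sub>p f) \<cdot>\<^sub>p r \<in> \<Gamma>" "(?c \<cdot>\<^sub>p g) \<cdot>\<^sub>p r \<in> \<Gamma>"
    using cf cg G e by (auto intro: concat_in)
  ultimately show ?thesis
    using G c e cancel[of f g ?c r] by (simp add: composable_def)
qed

section \<open>The path category\<close>

lemma Obj_path_category [simp]: "Obj (path_category X \<Gamma> R) = X"
  by (simp add: path_category_def)

lemma Ident_path_category [simp]:
  "Ident (path_category X \<Gamma> R) x = R `` {const_path x}"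
  by (simp add: path_category_def)

lemma Hom_path_categoryI:
  "\<lbrakk>g \<in> \<Gamma>; g 0 = x; g 1 = y\<rbrakk> \<Longrightarrow> R `` {g} \<in> Hom (path_category X \<Gamma> R) x y"
  by (auto simp: path_category_def)

lemma Hom_path_categoryE:
  assumes "f \<in> Hom (path_category X \<Gamma> R) x y"
  obtains g where "g \<in> \<Gamma>" "g 0 = x" "g 1 = y" "f = R `` {g}"
  using assms by (auto simp: path_category_def)

text \<open>The two memberships yield two representatives of \<open>s\<close>, one inside a pixel
  and one with the prescribed endpoints. They are equivalent, and equivalent paths share endpoints,
  so the first has both properties.\<close>

lemma screen_morphismE:
  assumes "s \<in> screen_morphisms \<Gamma> R P \<inter> Hom (path_category X \<Gamma> R) x y"
  obtains r where "r \<in> \<Gamma>" "r 0 = x" "r 1 = y" "in_pixel P r" "s = R `` {r}"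
proof -
  obtain r where r: "r \<in> \<Gamma>" "in_pixel P r" "s = R `` {r}"
    using assms by (auto simp: screen_morphisms_def in_pixel_def)
  obtain g where g: "g \<in> \<Gamma>" "g 0 = x" "g 1 = y" "s = R `` {g}"
    using assms by (auto elim: Hom_path_categoryE)
  have "(r, g) \<in> R"
    using r g class_eq_iff by blast
  then show thesis
    using that r g endpoints by metis
qed

lemma category_path_category: "category (path_category X \<Gamma> R)"
proof
  fix x y z f g
  assume "f \<in> Hom (path_category X \<Gamma> R) x y" "g \<in> Hom (path_category X \<Gamma> R) y z"
  then show "g \<circ>\<^bsub>path_category X \<Gamma> R\<^esub> f \<in> Hom (path_category X \<Gamma> R) x z"
    by (auto elim!: Hom_path_categoryE simp: path_category_comp intro!: Hom_path_categoryI concat_in)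
next
  fix x
  assume "x \<in> Obj (path_category X \<Gamma> R)"
  then show "Ident (path_category X \<Gamma> R) x \<in> Hom (path_category X \<Gamma> R) x x"
    by (auto intro!: Hom_path_categoryI const_closed)
next
  fix x y f
  assume "f \<in> Hom (path_category X \<Gamma> R) x y"
  then obtain g where g: "g \<in> \<Gamma>" "g 0 = x" "g 1 = y" "f = R `` {g}"
    by (rule Hom_path_categoryE)
  have c: "const_path x \<in> \<Gamma>" "const_path y \<in> \<Gamma>"
    using g endpoints_in const_closed by auto
  \<comment> \<open>Composition is written in the opposite order to concatenation, so the left unit
    law concerns a constant path appended at the end.\<close>
  show "Ident (path_category X \<Gamma> R) y \<circ>\<^bsub>path_category X \<Gamma> R\<^esub> f = f"
    using g c concat_const_rel[OF g(1)] by (simp add: path_category_comp class_eq_iff concat_in)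
  show "f \<circ>\<^bsub>path_category X \<Gamma> R\<^esub> Ident (path_category X \<Gamma> R) x = f"
    using g c const_concat_rel[OF g(1)] by (simp add: path_category_comp class_eq_iff concat_in)
next
  fix w x y z f g h
  assume "f \<in> Hom (path_category X \<Gamma> R) w x" "g \<in> Hom (path_category X \<Gamma> R) x y"
    "h \<in> Hom (path_category X \<Gamma> R) y z"
  then show "(h \<circ>\<^bsub>path_category X \<Gamma> R\<^esub> g) \<circ>\<^bsub>path_category X \<Gamma> R\<^esub> f
    = h \<circ>\<^bsub>path_category X \<Gamma> R\<^esub> (g \<circ>\<^bsub>path_category X \<Gamma> R\<^esub> f)"
    by (elim Hom_path_categoryE)
      (simp add: path_category_comp class_eq_iff concat_in concat_assoc_rel)
next
  fix x y x' y' f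
  assume "f \<in> Hom (path_category X \<Gamma> R) x y" "f \<in> Hom (path_category X \<Gamma> R) x' y'"
  \<comment> \<open>Representatives of one class are equivalent, so a class determines its source
    and target.\<close>
  then show "x = x' \<and> y = y'"
    using endpoints by (fastforce elim!: Hom_path_categoryE simp: class_eq_iff)
qed

end

section \<open>The calculus of fractions given by a screen\<close>

context screen
begin

lemma screen_morphismI:
  "\<lbrakk>r \<in> \<Gamma>; in_pixel P r\<rbrakk> \<Longrightarrow> R `` {r} \<in> screen_morphisms \<Gamma> R P"
  by (auto simp: screen_morphisms_def in_pixel_def)

lemma in_pixel_const_path: "x \<in> X \<Longrightarrow> in_pixel P (const_path x)"
  using partition by (auto simp: in_pixel_def partition_on_def)

lemma in_pixel_concat:
  assumes "in_pixel P r" "in_pixel P s" "r 1 = s 0"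
  shows "in_pixel P (r \<cdot>\<^sub>p s)"
proof -
  obtain A B where A: "A \<in> P" "im r \<subseteq> A" and B: "B \<in> P" "im s \<subseteq> B"
    using assms by (auto simp: in_pixel_def)
  have "r 1 \<in> A \<inter> B"
    using A B assms(3) end_in_im[of r] start_in_im[of s] by auto
  then have "A = B"
    using partition A B by (meson disjointD disjoint_iff IntD1 IntD2 partition_onD2)
  then show ?thesis
    using A B im_path_concat[of r s] by (auto simp: in_pixel_def)
qed

lemma calculus_of_fractions_screen:
  "calculus_of_fractions (path_category X \<Gamma> R) (screen_morphisms \<Gamma> R P)"
proof -
  let ?C = "path_category X \<Gamma> R" and ?S = "screen_morphisms \<Gamma> R P"
  interpret category ?C
    by (rule category_path_category)
  \<comment> \<open>Besides giving the first condition, identities are the witnesses in both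
    cancellation conditions.\<close>
  have Ident_S: "Ident ?C x \<in> ?S \<inter> Hom ?C x x" if "x \<in> X" for x
    using that by (auto intro!: screen_morphismI Hom_path_categoryI const_closed in_pixel_const_path)
  show ?thesis
  proof
    show "?S \<subseteq> (\<Union>x\<in>Obj ?C. \<Union>y\<in>Obj ?C. Hom ?C x y)"
      using endpoints_in by (fastforce simp: screen_morphisms_def intro!: Hom_path_categoryI)
  next
    fix x
    assume "x \<in> Obj ?C"
    then show "Ident ?C x \<in> ?S"
      using Ident_S by simp
  next
    fix x y z s s'
    assume "s \<in> ?S \<inter> Hom ?C x y" "s' \<in> ?S \<inter> Hom ?C y z"
    then show "s' \<circ>\<^bsub>?C\<^esub> s \<in> ?S"
      by (elim screen_morphismE)
        (auto simp: path_category_comp intro!: screen_morphismI concat_in in_pixel_concat)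
  next
    fix x x' y s f
    assume "s \<in> ?S \<inter> Hom ?C x x'" "f \<in> Hom ?C x y"
    then obtain r g where r: "r \<in> \<Gamma>" "r 0 = x" "r 1 = x'" "in_pixel P r" "s = R `` {r}"
      and g: "g \<in> \<Gamma>" "g 0 = x" "g 1 = y" "f = R `` {g}"
      by (metis Hom_path_categoryE screen_morphismE)
    then obtain r' g' where r': "r' \<in> \<Gamma>" "in_pixel P r'" "g 1 = r' 0"
      and g': "g' \<in> \<Gamma>" "r 1 = g' 0" and rel: "(g \<cdot>\<^sub>p r', r \<cdot>\<^sub>p g') \<in> R"
      using S3[of r g] by (auto simp: composable_def)
    \<comment> \<open>The two sides of the square from \<open>S3\<close> are equivalent and so end
      at the same point, which becomes the object \<open>y'\<close>.\<close>
    have "g' 1 = r' 1"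
      using endpoints[OF rel] by simp
    moreover have "R `` {g'} \<circ>\<^bsub>?C\<^esub> s = R `` {r'} \<circ>\<^bsub>?C\<^esub> f"
      using r g r' g' rel_sym[OF rel] by (simp add: path_category_comp class_eq_iff concat_in)
    ultimately show "\<exists>y'\<in>Obj ?C. \<exists>s'\<in>?S \<inter> Hom ?C y y'. \<exists>f'\<in>Hom ?C x' y'.
        f' \<circ>\<^bsub>?C\<^esub> s = s' \<circ>\<^bsub>?C\<^esub> f"
      using r g r' g' endpoints_in
      by (intro bexI[of _ "r' 1"] bexI[of _ "R `` {r'}"] bexI[of _ "R `` {g'}"])
        (auto intro!: Hom_path_categoryI screen_morphismI)
  next
    fix w x y s f g
    assume y: "y \<in> Obj ?C" and "s \<in> ?S \<inter> Hom ?C w x" "f \<in> Hom ?C x y" "g \<in> Hom ?C x y"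
      "f \<circ>\<^bsub>?C\<^esub> s = g \<circ>\<^bsub>?C\<^esub> s"
    \<comment> \<open>\<open>s\<close> is epic, so \<open>f\<close> and \<open>g\<close> already
      coincide and the identity of \<open>y\<close> can be taken for \<open>s'\<close>.\<close>
    then have "f = g"
      by (elim screen_morphismE Hom_path_categoryE)
        (auto simp: path_category_comp class_eq_iff concat_in intro: concat_left_cancel)
    then show "\<exists>z\<in>Obj ?C. \<exists>s'\<in>?S \<inter> Hom ?C y z. s' \<circ>\<^bsub>?C\<^esub> f = s' \<circ>\<^bsub>?C\<^esub> g"
      using y Ident_S by auto
  next
    fix x x' y s f
    assume "s \<in> ?S \<inter> Hom ?C x' x" "f \<in> Hom ?C y x"
    then obtain r g where r: "r \<in> \<Gamma>" "r 0 = x'" "r 1 = x" "in_pixel P r" "s = R `` {r}"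
      and g: "g \<in> \<Gamma>" "g 0 = y" "g 1 = x" "f = R `` {g}"
      by (metis Hom_path_categoryE screen_morphismE)
    \<comment> \<open>Primes are swapped relative to \<open>S3_dual\<close>: here the given paths
      are \<open>r\<close> and \<open>g\<close>, and the primed ones are produced. Their common
      start will be \<open>y'\<close>.\<close>
    then obtain r' g' where r': "r' \<in> \<Gamma>" "in_pixel P r'" "r' 1 = g 0"
      and g': "g' \<in> \<Gamma>" "g' 1 = r 0" and rel: "(g' \<cdot>\<^sub>p r, r' \<cdot>\<^sub>p g) \<in> R"
      using S3_dual[of r g] by (auto simp: composable_def)
    have "g' 0 = r' 0"
      using endpoints[OF rel] by simp
    moreover have "s \<circ>\<^bsub>?C\<^esub> R `` {g'} = f \<circ>\<^bsub>?C\<^esub> R `` {r'}"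
      using r g r' g' rel by (simp add: path_category_comp class_eq_iff concat_in)
    ultimately show "\<exists>y'\<in>Obj ?C. \<exists>s'\<in>?S \<inter> Hom ?C y' y. \<exists>f'\<in>Hom ?C y' x'.
        s \<circ>\<^bsub>?C\<^esub> f' = f \<circ>\<^bsub>?C\<^esub> s'"
      using r g r' g' endpoints_in
      by (intro bexI[of _ "r' 0"] bexI[of _ "R `` {r'}"] bexI[of _ "R `` {g'}"])
        (auto intro!: Hom_path_categoryI screen_morphismI)
  next
    fix x y z s f g
    assume x: "x \<in> Obj ?C" and "s \<in> ?S \<inter> Hom ?C y z" "f \<in> Hom ?C x y" "g \<in> Hom ?C x y"
      "s \<circ>\<^bsub>?C\<^esub> f = s \<circ>\<^bsub>?C\<^esub> g"
    \<comment> \<open>Dually, \<open>s\<close> is monic, and the identity of \<open>x\<close> can be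
      taken for \<open>s'\<close>.\<close>
    then have "f = g"
      by (elim screen_morphismE Hom_path_categoryE)
        (auto simp: path_category_comp class_eq_iff concat_in intro: concat_right_cancel)
    then show "\<exists>w\<in>Obj ?C. \<exists>s'\<in>?S \<inter> Hom ?C w x. f \<circ>\<^bsub>?C\<^esub> s' = g \<circ>\<^bsub>?C\<^esub> s'"
      using x Ident_S by auto
  qed
qed

end

theorem proposition2p17:
  fixes X :: "'a set" and \<Gamma> :: "(real \<Rightarrow> 'a) set" and R :: "(real \<Rightarrow> 'a) rel"
    and P :: "'a set set"
  assumes "path_triple X \<Gamma> R"
    and "screen X \<Gamma> R P"
  shows "calculus_of_fractions (path_category X \<Gamma> R) (screen_morphisms \<Gamma> R P)"
  using assms(2) by (rule screen.calculus_of_fractions_screen)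

end
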